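(* Let $\Theta\subseteq\mathbb{R}$ be the parameter space, and consider the hypotheses $\Theta_0\subset\Theta$ and $\Theta_1=\Theta\setminus\Theta_0$, both uncountable, with prior probabilities $\mathrm{P}(\Theta_0)>0$ and $\mathrm{P}(\Theta_1)>0$. Let $\varphi$ be a test function of the data $x$ with values in $\{0,1\}$, such that $\Theta_0$ is rejected if $\varphi=1$ and accepted if $\varphi=0$. Let $0<\alpha<1/2$. Under an absolutely continuous prior for $\theta$ (with proper, absolutely continuous posterior) and the loss function \[ L_{(2)}(\theta,\varphi) = \begin{cases} 0, & \text{if } \varphi=1-\mathbb{I}_{\Theta_0}(\theta), \\ \alpha, & \text{if } \theta\in\Theta_0 \text{ and }\varphi=1,\\ 1-\alpha, & \text{if } \theta\in\Theta_1 \text{ and }\varphi=0, \end{cases} \] the Bayes test is to reject $\Theta_0$ if and only if there exists at least one $\alpha$ credible set that does not contain a non-null subset of $\Theta_0$, or, equivalently, if and only if $\mathrm{P}(\theta\in\Theta_0|x)\leq 1-\alpha$.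
   Context: The parameter $\theta$ is real-valued, with parameter space $\Theta\subseteq\mathbb{R}$; hypotheses and credible sets are measurable subsets of $\Theta$. $\mathrm{P}(\cdot|x)$ denotes posterior probability given the data $x$, and $\mathbb{I}_{\Theta_0}$ is the indicator function of $\Theta_0$. For $0<\gamma<1$, a $\gamma$ credible set is a set $\Theta_c\subseteq\Theta$ with $\mathrm{P}(\theta\in\Theta_c|x)\geq\gamma$; in particular an $\alpha$ credible set satisfies $\mathrm{P}(\theta\in\Theta_c|x)\geq\alpha$. A credible set $\Theta_c$ contains a non-null subset of $\Theta_0$ if $\mathrm{P}(\theta\in\Theta_0\cap\Theta_c|x)>0$. A Bayes test is a test function which, for each $x$, chooses a decision minimizing the posterior expected loss $\mathrm{E}(L_{(2)}(\theta,\varphi)|x)$; if both decisions attain the minimum, either may be chosen. Saying that the Bayes test is to reject $\Theta_0$ if and only if a condition holds means that the test function equal to $1$ exactly when the condition holds is a Bayes test. *)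

theory Defs
  imports "HOL-Probability.Probability"
begin

text \<open>
  The data are drawn from the Markov kernel \<open>K \<theta>\<close> on the sample space \<open>X\<close>. The posterior \<open>Q\<close> is a
  version of the conditional distribution of the parameter given the data: it disintegrates the
  joint law of parameter and data along its marginal \<open>bind prior K\<close> on \<open>X\<close>. No dominating measure
  for the model is needed; in a dominated model this is what Bayes' formula yields.
  The prior may be improper. Sigma-finiteness of the marginal, automatic for a proper prior,
  ensures that the posterior is determined almost everywhere by the prior and the model.
  Properness of the posterior is the requirement that \<open>Q\<close> takes values in \<open>prob_algebra prior\<close>, the
  probability measures on the measurable space underlying \<open>prior\<close>.
\<close>

definition proper_posterior ::
  "'t measure \<Rightarrow> 'x measure \<Rightarrow> ('t \<Rightarrow> 'x measure) \<Rightarrow> ('x \<Rightarrow> 't measure) \<Rightarrow> bool" where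
  "proper_posterior prior X K Q \<longleftrightarrow>
     sigma_finite_measure (bind prior K) \<and>
     Q \<in> X \<rightarrow>\<^sub>M prob_algebra prior \<and>
     (\<forall>A\<in>sets prior. \<forall>B\<in>sets X.
        (\<integral>\<^sup>+\<theta>\<in>A. emeasure (K \<theta>) B \<partial>prior) = (\<integral>\<^sup>+x\<in>B. emeasure (Q x) A \<partial>(bind prior K)))"

definition test_function :: "'x measure \<Rightarrow> ('x \<Rightarrow> real) \<Rightarrow> bool" where
  "test_function X \<phi> \<longleftrightarrow> \<phi> \<in> borel_measurable X \<and> (\<forall>x\<in>space X. \<phi> x \<in> {0, 1})"

text \<open>Only decisions \<open>d \<in> {0, 1}\<close> and parameters in \<open>\<Theta>0 \<union> \<Theta>1\<close>, with \<open>\<Theta>0\<close> and \<open>\<Theta>1\<close>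
  disjoint, are meaningful; the last branch is never reached for these.\<close>

definition loss2 :: "real \<Rightarrow> 't set \<Rightarrow> 't set \<Rightarrow> 't \<Rightarrow> real \<Rightarrow> real" where
  "loss2 \<alpha> \<Theta>0 \<Theta>1 \<theta> d =
     (if d = 1 - indicator \<Theta>0 \<theta> then 0
      else if \<theta> \<in> \<Theta>0 \<and> d = 1 then \<alpha>
      else if \<theta> \<in> \<Theta>1 \<and> d = 0 then 1 - \<alpha>
      else undefined)"

definition expected_loss :: "('t \<Rightarrow> real \<Rightarrow> real) \<Rightarrow> 't measure \<Rightarrow> real \<Rightarrow> real" where
  "expected_loss L P d = (\<integral>\<theta>. L \<theta> d \<partial>P)"

definition bayes_test ::
  "('t \<Rightarrow> real \<Rightarrow> real) \<Rightarrow> 'x measure \<Rightarrow> ('x \<Rightarrow> 't measure) \<Rightarrow> ('x \<Rightarrow> real) \<Rightarrow> bool" where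
  "bayes_test L X Q \<phi> \<longleftrightarrow> test_function X \<phi> \<and>
     (\<forall>x\<in>space X. \<forall>d\<in>{0, 1}. expected_loss L (Q x) (\<phi> x) \<le> expected_loss L (Q x) d)"

definition bayes_test_rejects_iff ::
  "('t \<Rightarrow> real \<Rightarrow> real) \<Rightarrow> 'x measure \<Rightarrow> ('x \<Rightarrow> 't measure) \<Rightarrow> ('x \<Rightarrow> bool) \<Rightarrow> bool" where
  "bayes_test_rejects_iff L X Q R \<longleftrightarrow> bayes_test L X Q (\<lambda>x. if R x then 1 else 0)"

definition credible_set :: "real \<Rightarrow> 't measure \<Rightarrow> 't set \<Rightarrow> bool" where
  "credible_set \<gamma> P C \<longleftrightarrow> C \<in> sets P \<and> measure P C \<ge> \<gamma>"

definition contains_nonnull_subset :: "'t measure \<Rightarrow> 't set \<Rightarrow> 't set \<Rightarrow> bool" where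
  "contains_nonnull_subset P C H \<longleftrightarrow> measure P (H \<inter> C) > 0"

end

theory Submission imports Defs begin

text \<open>
  Write \<open>p\<close> for the posterior probability of the hypothesis \<open>\<Theta>0\<close>. Rejecting costs \<open>\<alpha>\<close> exactly
  on \<open>\<Theta>0\<close> and accepting costs \<open>1 - \<alpha>\<close> exactly off it, so the two expected losses are \<open>\<alpha> * p\<close>
  and \<open>(1 - \<alpha>) * (1 - p)\<close>. Their difference is \<open>p - (1 - \<alpha>)\<close>, hence rejection is optimal
  exactly when \<open>p \<le> 1 - \<alpha>\<close>.

  The same threshold governs credible sets. A set that meets \<open>\<Theta>0\<close> in a null set has at
  most the mass \<open>1 - p\<close> of the complement of \<open>\<Theta>0\<close>, and the complement itself attains this bound;
  so such a set of mass at least \<open>\<alpha>\<close> exists exactly when \<open>1 - p \<ge> \<alpha>\<close>.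

  Both arguments take place within a single posterior distribution. The dependence on the data
  enters only through measurability of the test, which holds because the posterior is
  a Markov kernel.
\<close>

text \<open>The complement of \<open>H\<close> is, up to null sets, the largest set that avoids \<open>H\<close>: it is a witness
  if there is one at all.\<close>

lemma (in prob_space) ex_credible_set_avoiding_iff:
  assumes H: "H \<in> events"
  shows "(\<exists>C. credible_set \<gamma> M C \<and> \<not> contains_nonnull_subset M C H) \<longleftrightarrow> prob H \<le> 1 - \<gamma>"
proof
  assume "\<exists>C. credible_set \<gamma> M C \<and> \<not> contains_nonnull_subset M C H"
  then obtain C where C: "C \<in> events" "\<gamma> \<le> prob C" and "\<not> prob (H \<inter> C) > 0"
    unfolding credible_set_def contains_nonnull_subset_def by blast
  then have "prob (H \<inter> C) = 0"
    by (simp add: zero_less_measure_iff)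
  then have "prob C = prob (C - H)"
    using C H by (simp add: finite_measure_Diff' Int_commute)
  also have "\<dots> \<le> prob (space M - H)"
    using C H sets.sets_into_space by (intro finite_measure_mono) auto
  also have "\<dots> = 1 - prob H"
    using H by (rule prob_compl)
  finally show "prob H \<le> 1 - \<gamma>"
    using C by linarith
next
  assume "prob H \<le> 1 - \<gamma>"
  then have "credible_set \<gamma> M (space M - H) \<and> \<not> contains_nonnull_subset M (space M - H) H"
    using H by (simp add: credible_set_def contains_nonnull_subset_def prob_compl)
  then show "\<exists>C. credible_set \<gamma> M C \<and> \<not> contains_nonnull_subset M C H"
    by blast
qed

lemma (in prob_space) expected_loss2_reject:
  assumes H: "H \<in> events"
  shows "expected_loss (loss2 \<alpha> H (space M - H)) M 1 = \<alpha> * prob H"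
proof -
  have "expected_loss (loss2 \<alpha> H (space M - H)) M 1 = (\<integral>\<theta>. \<alpha> * indicator H \<theta> \<partial>M)"
    unfolding expected_loss_def
    by (intro Bochner_Integration.integral_cong) (auto simp: loss2_def indicator_def)
  then show ?thesis
    using H by simp
qed

lemma (in prob_space) expected_loss2_accept:
  assumes H: "H \<in> events"
  shows "expected_loss (loss2 \<alpha> H (space M - H)) M 0 = (1 - \<alpha>) * (1 - prob H)"
proof -
  have "expected_loss (loss2 \<alpha> H (space M - H)) M 0
      = (\<integral>\<theta>. (1 - \<alpha>) * indicator (space M - H) \<theta> \<partial>M)"
    unfolding expected_loss_def
    by (intro Bochner_Integration.integral_cong) (auto simp: loss2_def indicator_def)
  then show ?thesis
    using H by (simp add: prob_compl)
qed

lemma (in prob_space) expected_loss2_reject_le_accept_iff: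
  assumes "H \<in> events"
  shows "expected_loss (loss2 \<alpha> H (space M - H)) M 1 \<le> expected_loss (loss2 \<alpha> H (space M - H)) M 0
    \<longleftrightarrow> prob H \<le> 1 - \<alpha>"
  unfolding expected_loss2_reject[OF assms] expected_loss2_accept[OF assms]
  by (simp add: algebra_simps)

text \<open>At equality of the two expected losses the test rejects, which is a legitimate choice because
  a Bayes test may take either decision there.\<close>

lemma bayes_test_rejects_iff_posterior_prob_le:
  assumes Q: "Q \<in> X \<rightarrow>\<^sub>M prob_algebra N" and H: "H \<in> sets N"
  shows "bayes_test_rejects_iff (loss2 \<alpha> H (space N - H)) X Q (\<lambda>x. measure (Q x) H \<le> 1 - \<alpha>)"
  unfolding bayes_test_rejects_iff_def bayes_test_def
proof (intro conjI ballI)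
  have "(\<lambda>x. measure (Q x) H) \<in> borel_measurable X"
    using measurable_prob_algebraD[OF Q] H by (rule measurable_compose[OF _ measurable_measure_subprob_algebra])
  then show "test_function X (\<lambda>x. if measure (Q x) H \<le> 1 - \<alpha> then 1 else 0)"
    unfolding test_function_def by simp
next
  fix x and d :: real
  assume x: "x \<in> space X" and d: "d \<in> {0, 1}"
  have "Q x \<in> space (prob_algebra N)"
    using Q x by (rule measurable_space)
  then have "prob_space (Q x)" and sets: "sets (Q x) = sets N"
    by (auto simp: space_prob_algebra)
  then interpret prob_space "Q x" by simp
  have "space (Q x) = space N"
    using sets by (rule sets_eq_imp_space_eq)
  then have "expected_loss (loss2 \<alpha> H (space N - H)) (Q x) 1
        \<le> expected_loss (loss2 \<alpha> H (space N - H)) (Q x) 0 \<longleftrightarrow> prob H \<le> 1 - \<alpha>"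
    using expected_loss2_reject_le_accept_iff[of H \<alpha>] H sets by simp
  then show "expected_loss (loss2 \<alpha> H (space N - H)) (Q x) (if prob H \<le> 1 - \<alpha> then 1 else 0)
      \<le> expected_loss (loss2 \<alpha> H (space N - H)) (Q x) d"
    using d by auto
qed

lemma bayes_test_rejects_iff_cong:
  assumes "\<And>x. x \<in> space X \<Longrightarrow> R x \<longleftrightarrow> R' x"
  shows "bayes_test_rejects_iff L X Q R \<longleftrightarrow> bayes_test_rejects_iff L X Q R'"
proof -
  have "(\<lambda>x. if R x then 1 else 0 :: real) \<in> borel_measurable X
      \<longleftrightarrow> (\<lambda>x. if R' x then 1 else 0 :: real) \<in> borel_measurable X"
    by (rule measurable_cong) (simp add: assms)
  then show ?thesis
    unfolding bayes_test_rejects_iff_def bayes_test_def test_function_def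
    by (simp add: assms)
qed

theorem theorem3:
  fixes \<Theta> \<Theta>0 \<Theta>1 :: "real set" and \<alpha> :: real
    and prior :: "real measure" and X :: "'x measure"
    and K :: "real \<Rightarrow> 'x measure" and Q :: "'x \<Rightarrow> real measure"
  assumes "\<Theta> \<in> sets borel" and "\<Theta>0 \<in> sets borel" and "\<Theta>0 \<subset> \<Theta>" and "\<Theta>1 = \<Theta> - \<Theta>0"
    and "uncountable \<Theta>0" and "uncountable \<Theta>1"
    and "sets prior = sets (restrict_space lborel \<Theta>)"
    and "sigma_finite_measure prior"
    and "absolutely_continuous (restrict_space lborel \<Theta>) prior"
    and "emeasure prior \<Theta>0 > 0" and "emeasure prior \<Theta>1 > 0"
    and "K \<in> prior \<rightarrow>\<^sub>M prob_algebra X"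
    and "proper_posterior prior X K Q"
    and "\<And>x. x \<in> space X \<Longrightarrow> absolutely_continuous (restrict_space lborel \<Theta>) (Q x)"
    and "0 < \<alpha>" and "\<alpha> < 1 / 2"
  shows "bayes_test_rejects_iff (loss2 \<alpha> \<Theta>0 \<Theta>1) X Q
           (\<lambda>x. \<exists>C. credible_set \<alpha> (Q x) C \<and> \<not> contains_nonnull_subset (Q x) C \<Theta>0) \<and>
         bayes_test_rejects_iff (loss2 \<alpha> \<Theta>0 \<Theta>1) X Q (\<lambda>x. measure (Q x) \<Theta>0 \<le> 1 - \<alpha>) \<and>
         (\<forall>x\<in>space X.
           (\<exists>C. credible_set \<alpha> (Q x) C \<and> \<not> contains_nonnull_subset (Q x) C \<Theta>0) \<longleftrightarrow>
           measure (Q x) \<Theta>0 \<le> 1 - \<alpha>)"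
proof -
  let ?C = "\<lambda>x. \<exists>C. credible_set \<alpha> (Q x) C \<and> \<not> contains_nonnull_subset (Q x) C \<Theta>0"
  let ?P = "\<lambda>x. measure (Q x) \<Theta>0 \<le> 1 - \<alpha>"
  have space_prior: "space prior = \<Theta>"
    using sets_eq_imp_space_eq[OF assms(7)] by (simp add: space_restrict_space)
  have H: "\<Theta>0 \<in> sets prior"
    using assms(1-3,7) by (auto simp: sets_restrict_space_iff)
  have Q: "Q \<in> X \<rightarrow>\<^sub>M prob_algebra prior"
    using assms(13) by (simp add: proper_posterior_def)
  have equiv: "?C x \<longleftrightarrow> ?P x" if "x \<in> space X" for x
  proof -
    have "Q x \<in> space (prob_algebra prior)"
      using Q that by (rule measurable_space)
    then have "prob_space (Q x)" "\<Theta>0 \<in> sets (Q x)"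
      using H by (auto simp: space_prob_algebra)
    then show ?thesis
      by (rule prob_space.ex_credible_set_avoiding_iff)
  qed
  have "bayes_test_rejects_iff (loss2 \<alpha> \<Theta>0 (space prior - \<Theta>0)) X Q ?P"
    using Q H by (rule bayes_test_rejects_iff_posterior_prob_le)
  then have P: "bayes_test_rejects_iff (loss2 \<alpha> \<Theta>0 \<Theta>1) X Q ?P"
    by (simp add: space_prior assms(4))
  moreover have "bayes_test_rejects_iff (loss2 \<alpha> \<Theta>0 \<Theta>1) X Q ?C"
    using equiv by (subst bayes_test_rejects_iff_cong[where R' = ?P]) (use P in auto)
  ultimately show ?thesis
    using equiv by blast
qed

end
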